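(* Let $K=[-1,1]\times[0,1]$, with generic points $\varpi=(w,h)$ and $\varpi_*=(w_*,h_* )$. Fix $p\in[0,1]$, $\alpha\in[0,1]$ and probability measures $f_0^S,f_0^{NS}\in P(K)$. For each $\gamma\in(0,1)$ let $f_\gamma^{NS}\in C([0,+\infty),P(K))\cap C^1((0,+\infty),P(K))$ (with $P(K)$ endowed with the total variation norm) be a solution with $f_\gamma^{NS}(0)=f_0^{NS}$ of $$\frac{d}{dt}\int_K\phi(\varpi)\,f_\gamma^{NS}(t,d\varpi)=\int_{K\times K}\big[\phi(w+\gamma(w_*-w),h)-\phi(w,h)\big]\big(p+(1-p)1_{h_*\ge h}\big)\,f_\gamma^{NS}(t,d\varpi)\,f_\gamma(t,d\varpi_* )$$ for all $\phi\in C(K)$, where $f_\gamma(t)=\alpha f_0^S+(1-\alpha)f_\gamma^{NS}(t)$. Define the time-rescaled measures $g_\gamma(\tau):=f_\gamma^{NS}(\tau/\gamma)$, $\tau\ge0$. Then there exist a sequence $\gamma_k\to0$ and $f^{NS}\in C([0,+\infty),P(K))$ (with $P(K)$ endowed with the weak topology) such that for every $T>0$, $$\sup_{\tau\in[0,T]}W_1\big(g_{\gamma_k}(\tau),f^{NS}(\tau)\big)\to0\quad\text{as }k\to\infty.$$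
   Context: $P(K)$ denotes the set of Borel probability measures on $K$. The weak topology on $P(K)$ is convergence of integrals against all continuous functions on $K$; it is metrized by the Wasserstein distance $W_1(f,g)=\sup\{\int_K\phi\,d(f-g):\ \phi:K\to\mathbb{R}\ 1\text{-Lipschitz}\}$. Interpretation: $w$ is an opinion, $h$ a hierarchy level, $\alpha$ the fraction of stubborn individuals (whose distribution $f_0^S$ is constant in time), $f_\gamma^{NS}$ the distribution of non-stubborn individuals, $\gamma$ the interaction strength and $p$ the probability that a lower-ranked individual convinces a higher-ranked one. *)

theory Defs
  imports "HOL-Probability.Probability"
begin

definition KK :: "(real \<times> real) set" where
  "KK = {-1..1} \<times> {0..1}"

definition borelK :: "(real \<times> real) measure" where
  "borelK = restrict_space borel KK"

definition PK :: "(real \<times> real) measure set" where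
  "PK = {M. prob_space M \<and> sets M = sets borelK}"

text \<open>Total variation size of a set function on the Borel sets of K
  (equivalent, up to a factor between 1 and 2, to the total variation norm).\<close>
definition tv_norm :: "((real \<times> real) set \<Rightarrow> real) \<Rightarrow> real" where
  "tv_norm \<nu> = (SUP A \<in> sets borelK. \<bar>\<nu> A\<bar>)"

definition tv_dist :: "(real \<times> real) measure \<Rightarrow> (real \<times> real) measure \<Rightarrow> real" where
  "tv_dist M N = tv_norm (\<lambda>A. measure M A - measure N A)"

definition signed_measure_K :: "((real \<times> real) set \<Rightarrow> real) \<Rightarrow> bool" where
  "signed_measure_K \<nu> \<longleftrightarrow> \<nu> {} = 0 \<and>
     (\<forall>A :: nat \<Rightarrow> (real \<times> real) set. range A \<subseteq> sets borelK \<longrightarrow> disjoint_family A \<longrightarrow>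
        (\<lambda>i. \<nu> (A i)) sums \<nu> (\<Union>i. A i))"

definition tv_continuous_from_0 :: "(real \<Rightarrow> (real \<times> real) measure) \<Rightarrow> bool" where
  "tv_continuous_from_0 f \<longleftrightarrow>
     (\<forall>t\<ge>0. ((\<lambda>s. tv_dist (f s) (f t)) \<longlongrightarrow> 0) (at t within {0..}))"

definition tv_C1_pos :: "(real \<Rightarrow> (real \<times> real) measure) \<Rightarrow> bool" where
  "tv_C1_pos f \<longleftrightarrow>
     (\<exists>D :: real \<Rightarrow> (real \<times> real) set \<Rightarrow> real.
        (\<forall>t>0. signed_measure_K (D t)) \<and>
        (\<forall>t>0. ((\<lambda>s. tv_norm (\<lambda>A. (measure (f s) A - measure (f t) A) / (s - t) - D t A))
                 \<longlongrightarrow> 0) (at t)) \<and>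
        (\<forall>t>0. ((\<lambda>s. tv_norm (\<lambda>A. D s A - D t A)) \<longlongrightarrow> 0) (at t)))"

definition weak_continuous_from_0 :: "(real \<Rightarrow> (real \<times> real) measure) \<Rightarrow> bool" where
  "weak_continuous_from_0 f \<longleftrightarrow>
     (\<forall>\<phi> :: real \<times> real \<Rightarrow> real. continuous_on KK \<phi> \<longrightarrow>
        continuous_on {0..} (\<lambda>t. integral\<^sup>L (f t) \<phi>))"

definition W1 :: "(real \<times> real) measure \<Rightarrow> (real \<times> real) measure \<Rightarrow> real" where
  "W1 M N = Sup {integral\<^sup>L M \<phi> - integral\<^sup>L N \<phi> | \<phi> :: real \<times> real \<Rightarrow> real. lipschitz_on 1 KK \<phi>}"

definition kern :: "real \<Rightarrow> real \<Rightarrow> (real \<times> real \<Rightarrow> real) \<Rightarrow> real \<times> real \<Rightarrow> real \<times> real \<Rightarrow> real" where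
  "kern p \<gamma> \<phi> z zs =
     (\<phi> (fst z + \<gamma> * (fst zs - fst z), snd z) - \<phi> z) *
     (p + (1 - p) * (if snd zs \<ge> snd z then 1 else 0))"

text \<open>Right-hand side of the weak equation, with
  f_gamma(t) = alpha f0S + (1-alpha) fNS(t) integrated linearly in the inner variable.\<close>
definition rhs :: "real \<Rightarrow> real \<Rightarrow> real \<Rightarrow> (real \<times> real) measure \<Rightarrow> (real \<times> real) measure
                   \<Rightarrow> (real \<times> real \<Rightarrow> real) \<Rightarrow> real" where
  "rhs p \<alpha> \<gamma> f0S fNS \<phi> =
     (\<integral>z. (\<alpha> * (\<integral>zs. kern p \<gamma> \<phi> z zs \<partial>f0S) + (1 - \<alpha>) * (\<integral>zs. kern p \<gamma> \<phi> z zs \<partial>fNS)) \<partial>fNS)"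

end

theory Submission
  imports Defs "HOL-Complex_Analysis.Great_Picard"
begin

text \<open>
  Testing the equation with an L-Lipschitz function, every jump has length at most
  2 gamma, so in the rescaled time the integrals against such functions are 2L-Lipschitz uniformly
  in gamma. The space P(K) is weakly sequentially compact: pulling measures back along a Borel
  section of a space-filling curve onto K reduces this to Helly's selection theorem on the line.
  A diagonal subsequence then converges at all rational times, hence at all times by the uniform
  Lipschitz bound, and Arzela--Ascoli for the 1-Lipschitz test functions makes the convergence
  uniform in W1 and locally uniform in time.
\<close>

subsection \<open>A space-filling curve\<close>

definition cos_step :: "real \<Rightarrow> real" where
  "cos_step t = max 0 (min 1 (1/2 - cos (pi * t)))"

lemma cos_step_range: "0 \<le> cos_step t" "cos_step t \<le> 1"
  by (auto simp: cos_step_def)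

lemma cos_step_periodic: "cos_step (2 * of_nat m + t) = cos_step t"
proof -
  have "cos (pi * (2 * real m + t)) = cos (pi * t + real (2 * m) * pi)"
    by (simp add: algebra_simps)
  also have "\<dots> = cos (pi * t)"
    by (simp add: cos_add)
  finally show ?thesis by (simp add: cos_step_def)
qed

lemma cos_step_low: 
  assumes "0 \<le> t" "t \<le> 1/3" shows "cos_step t = 0"
proof -
  have "cos (pi / 3) \<le> cos (pi * t)"
    by (rule cos_monotone_0_pi_le) (use assms in \<open>auto simp: field_simps\<close>)
  then show ?thesis by (simp add: cos_step_def cos_60)
qed

lemma cos_step_high: 
  assumes "2/3 \<le> t" "t \<le> 1" shows "cos_step t = 1"
proof -
  have "cos (pi * t) \<le> cos (pi - pi / 3)"
    by (rule cos_monotone_0_pi_le) (use assms in \<open>auto simp: field_simps\<close>)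
  also have "\<dots> = - (1/2)" by (simp only: cos_pi_minus cos_60)
  finally show ?thesis by (simp add: cos_step_def)
qed

lemma sums_half_powers: "(\<lambda>k. 1 / 2 ^ Suc k :: real) sums 1"
  using power_half_series by (simp add: power_one_over)

lemma continuous_on_step_series:
  "continuous_on UNIV (\<lambda>t::real. \<Sum>k. cos_step (s k * t) / 2 ^ Suc k)"
proof -
  have "uniform_limit UNIV (\<lambda>n t. \<Sum>k<n. cos_step (s k * t) / 2 ^ Suc k)
          (\<lambda>t. \<Sum>k. cos_step (s k * t) / 2 ^ Suc k) sequentially"
  proof (rule Weierstrass_m_test)
    show "summable (\<lambda>k. 1 / 2 ^ Suc k :: real)"
      using sums_half_powers by (rule sums_summable)
    show "norm (cos_step (s k * t) / 2 ^ Suc k) \<le> 1 / 2 ^ Suc k" for k t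
      using cos_step_range[of "s k * t"] by (simp add: divide_right_mono)
  qed
  then show ?thesis
    by (rule uniform_limit_theorem[rotated])
       (auto simp: cos_step_def intro!: always_eventually continuous_intros)
qed

lemma step_series_range:
  "(\<Sum>k. cos_step (s k * t) / 2 ^ Suc k) \<in> {0..1}"
proof -
  have s1: "summable (\<lambda>k. 1 / 2 ^ Suc k :: real)"
    using sums_half_powers by (rule sums_summable)
  have le: "cos_step (s k * t) / 2 ^ Suc k \<le> 1 / 2 ^ Suc k" for k
    using cos_step_range[of "s k * t"] by (intro divide_right_mono) auto
  have s2: "summable (\<lambda>k. cos_step (s k * t) / 2 ^ Suc k)"
    by (rule summable_comparison_test'[OF s1, of 0])
       (use cos_step_range in \<open>simp add: divide_right_mono\<close>)
  have "(\<Sum>k. cos_step (s k * t) / 2 ^ Suc k) \<le> (\<Sum>k. 1 / 2 ^ Suc k)"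
    by (rule suminf_le[OF le s2 s1])
  moreover have "0 \<le> (\<Sum>k. cos_step (s k * t) / 2 ^ Suc k)"
    by (rule suminf_nonneg[OF s2]) (use cos_step_range in auto)
  ultimately show ?thesis
    using sums_unique[OF sums_half_powers] by simp
qed

lemma binary_digits_exist:
  fixes x :: real
  assumes "x \<in> {0..1}"
  obtains a :: "nat \<Rightarrow> real" where "\<And>k. a k \<in> {0, 1}" "(\<lambda>k. a k / 2 ^ Suc k) sums x"
proof -
  define r where "r = rec_nat x (\<lambda>_ r. 2 * r - (if r \<ge> 1/2 then 1 else 0))"
  define a where "a k = (if r k \<ge> 1/2 then 1 else 0 :: real)" for k
  have r0: "r 0 = x" and rS: "r (Suc k) = 2 * r k - a k" for k
    by (auto simp: r_def a_def)
  have r_range: "0 \<le> r k \<and> r k \<le> 1" for k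
    by (induction k) (use assms in \<open>auto simp: r0 rS a_def\<close>)
  have part: "(\<Sum>k<n. a k / 2 ^ Suc k) = x - r n / 2 ^ n" for n
    by (induction n) (auto simp: r0 rS field_simps)
  have "(\<lambda>n. r n / 2 ^ n) \<longlonglongrightarrow> 0"
  proof (rule Lim_null_comparison)
    show "\<forall>\<^sub>F n in sequentially. norm (r n / 2 ^ n) \<le> (1/2) ^ n"
      using r_range by (auto simp: power_one_over divide_simps intro!: always_eventually)
    show "(\<lambda>n. (1/2::real) ^ n) \<longlonglongrightarrow> 0"
      by (rule LIMSEQ_power_zero) simp
  qed
  then have "(\<lambda>n. x - r n / 2 ^ n) \<longlonglongrightarrow> x - 0"
    by (intro tendsto_intros)
  then have "(\<lambda>k. a k / 2 ^ Suc k) sums x"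
    by (simp add: sums_def part del: power_Suc)
  with that[of a] show thesis by (auto simp: a_def)
qed

lemma cos_step_reads_ternary_digits:
  fixes d :: "nat \<Rightarrow> real"
  assumes d: "\<And>k. d k \<in> {0, 1}"
  obtains t where "t \<in> {0..1}" "\<And>n. cos_step (3 ^ n * t) = d n"
proof -
  define T where "T n = (\<Sum>j. 2 * d (n + j) / 3 ^ Suc j)" for n
  have geo: "(\<lambda>j. 2 / 3 ^ Suc j :: real) sums 1"
    using sums_mult[OF geometric_sums[of "1/3::real"], of "2/3"]
    by (simp add: power_one_over field_simps)
  have d01: "0 \<le> d k" "d k \<le> 1" for k using d[of k] by auto
  have sm: "summable (\<lambda>j. 2 * d (n + j) / 3 ^ Suc j)" for n
    by (rule summable_comparison_test'[OF sums_summable[OF geo], of 0])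
       (use d01 in \<open>auto simp: divide_right_mono\<close>)
  have T_nonneg: "0 \<le> T n" for n
    unfolding T_def by (rule suminf_nonneg[OF sm]) (use d01 in auto)
  have T_le: "T n \<le> 1" for n
  proof -
    have "T n \<le> (\<Sum>j. 2 / 3 ^ Suc j)"
      unfolding T_def by (rule suminf_le[OF _ sm sums_summable[OF geo]])
        (use d01 in \<open>auto simp: divide_right_mono\<close>)
    with sums_unique[OF geo] show ?thesis by simp
  qed
  have T_rec: "3 * T n = 2 * d n + T (Suc n)" for n
  proof -
    have "T n = 2 * d n / 3 + (\<Sum>j. 2 * d (n + Suc j) / 3 ^ Suc (Suc j))"
      unfolding T_def using suminf_split_head[OF sm[of n]] by simp
    also have "(\<lambda>j. 2 * d (n + Suc j) / 3 ^ Suc (Suc j)) = (\<lambda>j. (2 * d (Suc n + j) / 3 ^ Suc j) / 3)"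
      by (simp add: fun_eq_iff)
    also have "(\<Sum>j. (2 * d (Suc n + j) / 3 ^ Suc j) / 3) = T (Suc n) / 3"
      unfolding T_def by (rule suminf_divide[OF sm])
    finally show ?thesis by simp
  qed
  have "\<exists>m::nat. 3 ^ n * T 0 = 2 * of_nat m + T n" for n
  proof (induction n)
    case 0 show ?case by (rule exI[of _ 0]) simp
  next
    case (Suc n)
    then obtain m :: nat where "3 ^ n * T 0 = 2 * of_nat m + T n" by blast
    then have "3 ^ Suc n * T 0 = 2 * (3 * real m + d n) + T (Suc n)"
      using T_rec[of n] by simp
    moreover have "3 * real m + d n = real (3 * m + (if d n = 1 then 1 else 0))"
      using d[of n] by auto
    ultimately show ?case by metis
  qed
  moreover have "cos_step (T n) = d n" for n
  proof (cases "d n = 0")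
    case True
    with T_rec[of n] T_le[of "Suc n"] T_nonneg[of n] show ?thesis
      by (simp add: cos_step_low)
  next
    case False
    with d[of n] have "d n = 1" by auto
    with T_rec[of n] T_le[of n] T_nonneg[of "Suc n"] show ?thesis
      by (simp add: cos_step_high)
  qed
  ultimately have "cos_step (3 ^ n * T 0) = d n" for n
    using cos_step_periodic by metis
  with that[of "T 0"] T_nonneg[of 0] T_le[of 0] show thesis by auto
qed

text \<open>Schoenberg's construction: the ternary digits of the parameter encode the interleaved
  binary digits of the two coordinates.\<close>

lemma space_filling_curve:
  obtains c :: "real \<Rightarrow> real \<times> real"
  where "continuous_on UNIV c" "\<And>t. c t \<in> KK" "c ` {0..1} = KK"
proof -
  define X where "X t = (\<Sum>k. cos_step (3 ^ (2 * k) * t) / 2 ^ Suc k)" for t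
  define Y where "Y t = (\<Sum>k. cos_step (3 ^ (2 * k + 1) * t) / 2 ^ Suc k)" for t
  define c where "c t = (2 * X t - 1, Y t)" for t
  have "continuous_on UNIV X" "continuous_on UNIV Y"
    unfolding X_def Y_def by (rule continuous_on_step_series)+
  then have cont: "continuous_on UNIV c"
    unfolding c_def by (intro continuous_intros)
  have "X t \<in> {0..1}" "Y t \<in> {0..1}" for t
    unfolding X_def Y_def by (rule step_series_range)+
  then have range: "c t \<in> KK" for t
    unfolding c_def KK_def by (auto simp: field_simps)
  have "z \<in> c ` {0..1}" if "z \<in> KK" for z
  proof -
    obtain w h where z: "z = (w, h)" by (cases z)
    from that have wh: "(w + 1) / 2 \<in> {0..1}" "h \<in> {0..1}"
      by (auto simp: z KK_def)
    obtain a where a: "\<And>k. a k \<in> {0, 1}" "(\<lambda>k. a k / 2 ^ Suc k) sums ((w + 1) / 2)"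
      using binary_digits_exist[OF wh(1)] by blast
    obtain b where b: "\<And>k. b k \<in> {0, 1}" "(\<lambda>k. b k / 2 ^ Suc k) sums h"
      using binary_digits_exist[OF wh(2)] by blast
    define d where "d n = (if even n then a (n div 2) else b (n div 2))" for n
    have "d n \<in> {0, 1}" for n using a(1) b(1) unfolding d_def by (cases "even n") metis+
    then obtain t where t: "t \<in> {0..1}" "\<And>n. cos_step (3 ^ n * t) = d n"
      using cos_step_reads_ternary_digits by blast
    have "X t = (w + 1) / 2" "Y t = h"
      unfolding X_def Y_def t(2) using a(2) b(2) by (simp_all add: d_def sums_iff)
    then have "c t = z" by (simp add: c_def z)
    with t(1) show ?thesis by blast
  qed
  with range have "c ` {0..1} = KK" by blast
  with that cont range show thesis by blast
qed

subsection \<open>Weak compactness of P(K)\<close>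

lemma KK_compact: "compact KK"
  unfolding KK_def by (intro compact_Times) auto

lemma PK_prob: "M \<in> PK \<Longrightarrow> prob_space M"
  and PK_sets: "M \<in> PK \<Longrightarrow> sets M = sets borelK"
  by (auto simp: PK_def)

lemma PK_space: "M \<in> PK \<Longrightarrow> space M = KK"
  using sets_eq_imp_space_eq[OF PK_sets] by (simp add: borelK_def space_restrict_space)

lemma PK_measurable:
  fixes \<phi> :: "real \<times> real \<Rightarrow> real"
  assumes "M \<in> PK" "continuous_on KK \<phi>"
  shows "\<phi> \<in> borel_measurable M"
proof -
  have "\<phi> \<in> borel_measurable borelK"
    unfolding borelK_def by (rule borel_measurable_continuous_on_restrict[OF assms(2)])
  then show ?thesis
    by (simp add: measurable_cong_sets[OF PK_sets[OF assms(1)] refl])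
qed

lemma continuous_on_KK_bounded:
  fixes \<phi> :: "real \<times> real \<Rightarrow> real"
  assumes "continuous_on KK \<phi>"
  obtains B where "0 \<le> B" "\<And>z. z \<in> KK \<Longrightarrow> \<bar>\<phi> z\<bar> \<le> B"
proof -
  have "bounded (\<phi> ` KK)"
    by (rule compact_imp_bounded[OF compact_continuous_image[OF assms KK_compact]])
  then obtain B where "B > 0" "\<forall>x\<in>\<phi> ` KK. norm x \<le> B"
    by (auto simp: bounded_pos)
  with that[of B] show thesis by auto
qed

lemma PK_integrable:
  fixes \<phi> :: "real \<times> real \<Rightarrow> real"
  assumes "M \<in> PK" "continuous_on KK \<phi>"
  shows "integrable M \<phi>"
proof -
  interpret prob_space M by (rule PK_prob[OF assms(1)])
  obtain B where "\<And>z. z \<in> KK \<Longrightarrow> \<bar>\<phi> z\<bar> \<le> B"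
    using continuous_on_KK_bounded[OF assms(2)] by blast
  then show ?thesis
    by (intro integrable_const_bound[where B = B] PK_measurable[OF assms])
       (auto simp: PK_space[OF assms(1)])
qed

text \<open>Non-integrable functions are included: their Bochner integral is 0 by convention.\<close>

lemma (in prob_space) abs_integral_le_const:
  fixes g :: "'a \<Rightarrow> real"
  assumes "0 \<le> C" "\<And>x. x \<in> space M \<Longrightarrow> \<bar>g x\<bar> \<le> C"
  shows "\<bar>integral\<^sup>L M g\<bar> \<le> C"
proof (cases "integrable M g")
  case True
  have "\<bar>integral\<^sup>L M g\<bar> \<le> (\<integral>x. \<bar>g x\<bar> \<partial>M)"
    by (rule integral_abs_bound)
  also have "\<dots> \<le> (\<integral>x. C \<partial>M)"
    by (rule integral_mono) (use True assms in auto)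
  finally show ?thesis by (simp add: prob_space)
next
  case False
  with assms show ?thesis by (simp add: not_integrable_integral_eq)
qed

lemma PK_integral_close:
  fixes \<phi> \<psi> :: "real \<times> real \<Rightarrow> real"
  assumes M: "M \<in> PK" and "continuous_on KK \<phi>" "continuous_on KK \<psi>"
    and e: "0 \<le> e" "\<And>z. z \<in> KK \<Longrightarrow> \<bar>\<phi> z - \<psi> z\<bar> \<le> e"
  shows "\<bar>integral\<^sup>L M \<phi> - integral\<^sup>L M \<psi>\<bar> \<le> e"
proof -
  interpret prob_space M by (rule PK_prob[OF M])
  have "integral\<^sup>L M \<phi> - integral\<^sup>L M \<psi> = (\<integral>z. \<phi> z - \<psi> z \<partial>M)"
    using assms by (intro Bochner_Integration.integral_diff[symmetric] PK_integrable)
  then show ?thesis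
    using abs_integral_le_const[of e "\<lambda>z. \<phi> z - \<psi> z"] e by (simp add: PK_space[OF M])
qed

text \<open>The least preimage is lower semicontinuous, hence a Borel section.\<close>

lemma measurable_section:
  fixes c :: "real \<Rightarrow> real \<times> real"
  assumes c: "continuous_on UNIV c" "c ` {0..1} = KK"
  obtains s where "s \<in> borel_measurable borelK" "\<And>z. z \<in> KK \<Longrightarrow> s z \<in> {0..1}"
    "\<And>z. z \<in> KK \<Longrightarrow> c (s z) = z"
proof -
  define F where "F z = {0..1} \<inter> c -` {z}" for z
  define s where "s z = Inf (F z)" for z
  have "closed (c -` {z})" for z
    using continuous_closed_vimage[of "{z}" c] c(1) by (simp add: continuous_on_eq_continuous_at)
  then have compF: "compact (F z)" for z
    unfolding F_def by (intro compact_Int_closed) auto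
  have neF: "F z \<noteq> {}" if "z \<in> KK" for z
    using that c(2) by (force simp: F_def)
  have sF: "s z \<in> F z" if "z \<in> KK" for z
    unfolding s_def
    by (rule closed_contains_Inf[OF neF[OF that] _ compact_imp_closed[OF compF]])
       (auto simp: F_def intro: bdd_belowI[of _ 0])
  have s_le: "s z \<le> x" if "x \<in> F z" for x z
    unfolding s_def by (rule cInf_lower[OF that]) (auto simp: F_def intro: bdd_belowI[of _ 0])
  have "s \<in> borel_measurable borelK"
  proof (rule borel_measurableI_le)
    fix a
    have "{z \<in> space borelK. s z \<le> a} = c ` {0..min 1 a} \<inter> KK"
    proof (intro equalityI subsetI)
      fix z assume "z \<in> {z \<in> space borelK. s z \<le> a}"
      then have "z \<in> KK" "s z \<le> a" by (auto simp: borelK_def space_restrict_space)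
      with sF[of z] show "z \<in> c ` {0..min 1 a} \<inter> KK" by (force simp: F_def)
    next
      fix z assume "z \<in> c ` {0..min 1 a} \<inter> KK"
      then obtain x where "z \<in> KK" "x \<in> F z" "x \<le> a" by (auto simp: F_def)
      with s_le[of x z] show "z \<in> {z \<in> space borelK. s z \<le> a}"
        by (auto simp: borelK_def space_restrict_space)
    qed
    moreover have "compact (c ` {0..min 1 a})"
      by (rule compact_continuous_image[OF continuous_on_subset[OF c(1)]]) auto
    then have "c ` {0..min 1 a} \<in> sets borel"
      by (intro borel_closed compact_imp_closed)
    ultimately show "{z \<in> space borelK. s z \<le> a} \<in> sets borelK"
      by (auto simp: borelK_def sets_restrict_space)
  qed
  with that[of s] sF show thesis by (auto simp: F_def)
qed

lemma PK_sequentially_compact: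
  fixes M :: "nat \<Rightarrow> (real \<times> real) measure"
  assumes M: "\<And>n. M n \<in> PK"
  obtains r N where "strict_mono r" "N \<in> PK"
    "\<And>\<phi>::real \<times> real \<Rightarrow> real. continuous_on KK \<phi> \<Longrightarrow> (\<lambda>n. integral\<^sup>L (M (r n)) \<phi>) \<longlonglongrightarrow> integral\<^sup>L N \<phi>"
proof -
  obtain c :: "real \<Rightarrow> real \<times> real"
    where c: "continuous_on UNIV c" "\<And>t. c t \<in> KK" "c ` {0..1} = KK"
    using space_filling_curve by blast
  obtain s where s: "s \<in> borel_measurable borelK" "\<And>z. z \<in> KK \<Longrightarrow> s z \<in> {0..1}"
    "\<And>z. z \<in> KK \<Longrightarrow> c (s z) = z"
    using measurable_section[OF c(1,3)] by blast
  have s_meas: "s \<in> borel_measurable (M n)" for n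
    using s(1) by (simp add: measurable_cong_sets[OF PK_sets[OF M] refl])
  have c_meas: "c \<in> borel \<rightarrow>\<^sub>M borelK"
    unfolding borelK_def using c(1,2)
    by (intro measurable_restrict_space2 borel_measurable_continuous_onI) auto
  define L where "L n = distr (M n) borel s" for n
  have L: "real_distribution (L n)" for n
    unfolding L_def by (rule prob_space.real_distribution_distr[OF PK_prob[OF M] s_meas])
  have "tight L"
    unfolding tight_def
  proof (intro conjI allI impI L)
    fix e :: real assume "e > 0"
    have "measure (L n) {-1<..1} = 1" for n
    proof -
      interpret prob_space "M n" by (rule PK_prob[OF M])
      have "s -` {-1<..1} \<inter> space (M n) = space (M n)"
        using s(2) by (force simp: PK_space[OF M])
      then show ?thesis
        unfolding L_def by (simp add: measure_distr[OF s_meas] prob_space)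
    qed
    with \<open>e > 0\<close> show "\<exists>a b. a < b \<and> (\<forall>n. 1 - e < measure (L n) {a<..b})"
      by (intro exI[of _ "-1"] exI[of _ 1]) auto
  qed
  then obtain r N where r: "strict_mono r" and N: "real_distribution N"
    and conv: "weak_conv_m (L \<circ> id \<circ> r) N"
    using tight_imp_convergent_subsubsequence[of L id] by (auto simp: strict_mono_id)
  interpret N: real_distribution N by (rule N)
  have c_N: "c \<in> N \<rightarrow>\<^sub>M borelK"
    using c_meas by (simp add: measurable_cong_sets[OF N.events_eq_borel refl])
  have "distr N borelK c \<in> PK"
    unfolding PK_def using N.prob_space_distr[OF c_N] by simp
  moreover have "(\<lambda>n. integral\<^sup>L (M (r n)) \<phi>) \<longlonglongrightarrow> integral\<^sup>L (distr N borelK c) \<phi>"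
    if \<phi>: "continuous_on KK \<phi>" for \<phi> :: "real \<times> real \<Rightarrow> real"
  proof -
    obtain B where B: "\<And>z. z \<in> KK \<Longrightarrow> \<bar>\<phi> z\<bar> \<le> B"
      using continuous_on_KK_bounded[OF \<phi>] by blast
    have cont: "continuous_on UNIV (\<lambda>t. \<phi> (c t))"
      using continuous_on_compose2[OF \<phi> c(1)] c(2) by auto
    have "(\<lambda>n. integral\<^sup>L ((L \<circ> id \<circ> r) n) (\<lambda>t. \<phi> (c t))) \<longlonglongrightarrow> integral\<^sup>L N (\<lambda>t. \<phi> (c t))"
      by (rule weak_conv_imp_integral_bdd_continuous_conv[where B = B])
         (use L N conv cont B c(2) in \<open>auto simp: continuous_on_eq_continuous_at o_def\<close>)
    moreover have "integral\<^sup>L (L n) (\<lambda>t. \<phi> (c t)) = integral\<^sup>L (M n) \<phi>" for n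
    proof -
      have "integral\<^sup>L (L n) (\<lambda>t. \<phi> (c t)) = (\<integral>z. \<phi> (c (s z)) \<partial>M n)"
        unfolding L_def
        by (rule integral_distr[OF s_meas borel_measurable_continuous_onI[OF cont]])
      also have "\<dots> = integral\<^sup>L (M n) \<phi>"
        by (rule Bochner_Integration.integral_cong) (auto simp: s(3) PK_space[OF M])
      finally show ?thesis .
    qed
    moreover have "integral\<^sup>L (distr N borelK c) \<phi> = integral\<^sup>L N (\<lambda>t. \<phi> (c t))"
      by (rule integral_distr[OF c_N])
         (simp add: borelK_def borel_measurable_continuous_on_restrict[OF \<phi>])
    ultimately show ?thesis by simp
  qed
  ultimately show thesis using that r by blast
qed

subsection \<open>Lipschitz dependence on time\<close>

lemma tv_dist_ge:
  assumes "M \<in> PK" "N \<in> PK" "A \<in> sets borelK"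
  shows "\<bar>measure M A - measure N A\<bar> \<le> tv_dist M N"
  unfolding tv_dist_def tv_norm_def
proof (rule cSUP_upper[OF assms(3)])
  interpret M: prob_space M by (rule PK_prob[OF assms(1)])
  interpret N: prob_space N by (rule PK_prob[OF assms(2)])
  show "bdd_above ((\<lambda>A. \<bar>measure M A - measure N A\<bar>) ` sets borelK)"
  proof (rule bdd_aboveI2)
    fix A show "\<bar>measure M A - measure N A\<bar> \<le> 1"
      using M.prob_le_1[of A] N.prob_le_1[of A] measure_nonneg[of M A] measure_nonneg[of N A]
      by linarith
  qed
qed

lemma step_approximation:
  fixes x :: real
  assumes "0 \<le> x" "x \<le> 1" "n > 0"
  shows "\<bar>x - (\<Sum>k=1..n. indicator {real k / real n..} x) / real n\<bar> \<le> 1 / real n"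
proof -
  define m where "m = nat \<lfloor>real n * x\<rfloor>"
  have nx: "0 \<le> real n * x" "real n * x \<le> real n"
    using assms by (auto simp: mult_left_le)
  have m: "real m \<le> real n * x" "real n * x < real m + 1"
    using nx by (auto simp: m_def)
  have "{k \<in> {1..n}. real k / real n \<le> x} = {1..m}"
  proof (intro equalityI subsetI)
    fix k assume "k \<in> {k \<in> {1..n}. real k / real n \<le> x}"
    then have "1 \<le> k" "real k \<le> real n * x" using assms(3) by (auto simp: field_simps)
    with m(2) have "real k < real (Suc m)" by simp
    with \<open>1 \<le> k\<close> show "k \<in> {1..m}" by (simp only: of_nat_less_iff) simp
  next
    fix k assume k: "k \<in> {1..m}"
    then have "real k \<le> real m" by simp
    with m(1) have a: "real k \<le> real n * x" by linarith
    with nx(2) have "k \<le> n" by linarith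
    with a k assms(3) show "k \<in> {k \<in> {1..n}. real k / real n \<le> x}" by (auto simp: field_simps)
  qed
  moreover have "(\<Sum>k=1..n. indicator {real k / real n..} x :: real)
      = real (card {k \<in> {1..n}. real k / real n \<le> x})"
    by (simp add: indicator_def sum.If_cases Int_def)
  ultimately have "(\<Sum>k=1..n. indicator {real k / real n..} x :: real) = real m" by simp
  moreover have "\<bar>real n * x - real m\<bar> \<le> 1" using m by linarith
  moreover have "x - real m / real n = (real n * x - real m) / real n"
    using assms(3) by (simp add: field_simps)
  ultimately show ?thesis by (simp add: divide_right_mono)
qed

lemma tv_dist_integral_unit:
  fixes \<psi> :: "real \<times> real \<Rightarrow> real"
  assumes M: "M \<in> PK" and N: "N \<in> PK" and \<psi>: "continuous_on KK \<psi>"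
    and range: "\<And>z. z \<in> KK \<Longrightarrow> 0 \<le> \<psi> z \<and> \<psi> z \<le> 1"
  shows "\<bar>integral\<^sup>L M \<psi> - integral\<^sup>L N \<psi>\<bar> \<le> tv_dist M N"
proof -
  define A where "A n k = {z \<in> KK. real k / real n \<le> \<psi> z}" for n k :: nat
  define S where "S n z = (\<Sum>k=1..n. indicator (A n k) z) / real n" for n :: nat and z
  have A_sets: "A n k \<in> sets borelK" for n k
  proof -
    have "\<psi> \<in> borel_measurable borelK"
      unfolding borelK_def by (rule borel_measurable_continuous_on_restrict[OF \<psi>])
    then have "{z \<in> space borelK. real k / real n \<le> \<psi> z} \<in> sets borelK" by measurable
    then show ?thesis by (simp add: A_def borelK_def space_restrict_space)
  qed
  have S_int: "integrable Q (S n)"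
    and S_eq: "integral\<^sup>L Q (S n) = (\<Sum>k=1..n. measure Q (A n k)) / real n" if Q: "Q \<in> PK" for Q n
  proof -
    interpret prob_space Q by (rule PK_prob[OF Q])
    have [measurable]: "A n k \<in> sets Q" for k using A_sets by (simp add: PK_sets[OF Q])
    have [simp]: "A n k \<inter> space Q = A n k" for k by (auto simp: A_def PK_space[OF Q])
    show "integrable Q (S n)" unfolding S_def
      by (intro integrable_divide Bochner_Integration.integrable_sum) (simp add: emeasure_eq_measure)
    show "integral\<^sup>L Q (S n) = (\<Sum>k=1..n. measure Q (A n k)) / real n" unfolding S_def
      by (subst integral_divide_zero, subst Bochner_Integration.integral_sum)
         (simp_all add: emeasure_eq_measure)
  qed
  have S_close: "\<bar>integral\<^sup>L Q \<psi> - integral\<^sup>L Q (S n)\<bar> \<le> 1 / real n" if Q: "Q \<in> PK" and n: "n > 0" for Q n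
  proof -
    interpret prob_space Q by (rule PK_prob[OF Q])
    have "integral\<^sup>L Q \<psi> - integral\<^sup>L Q (S n) = (\<integral>z. \<psi> z - S n z \<partial>Q)"
      by (intro Bochner_Integration.integral_diff[symmetric] PK_integrable S_int Q \<psi>)
    moreover have "\<bar>\<psi> z - S n z\<bar> \<le> 1 / real n" if "z \<in> KK" for z
    proof -
      have "S n z = (\<Sum>k=1..n. indicator {real k / real n..} (\<psi> z)) / real n"
        using that by (simp add: S_def A_def indicator_def)
      with step_approximation[OF _ _ n, of "\<psi> z"] range[OF that] show ?thesis by simp
    qed
    ultimately show ?thesis
      using abs_integral_le_const[of "1 / real n" "\<lambda>z. \<psi> z - S n z"] by (simp add: PK_space[OF Q])
  qed
  have bound: "\<bar>integral\<^sup>L M \<psi> - integral\<^sup>L N \<psi>\<bar> \<le> tv_dist M N + 2 / real n" if n: "n > 0" for n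
  proof -
    have "\<bar>integral\<^sup>L M (S n) - integral\<^sup>L N (S n)\<bar>
        = \<bar>\<Sum>k=1..n. measure M (A n k) - measure N (A n k)\<bar> / real n"
      by (simp add: S_eq M N sum_subtractf diff_divide_distrib[symmetric])
    also have "\<dots> \<le> (\<Sum>k=1..n. tv_dist M N) / real n"
      by (intro divide_right_mono order_trans[OF sum_abs] sum_mono tv_dist_ge M N A_sets) simp
    also have "\<dots> = tv_dist M N" using n by simp
    finally show ?thesis
      using S_close[OF M n] S_close[OF N n] by (simp add: abs_if split: if_splits)
  qed
  show ?thesis
  proof (rule field_le_epsilon)
    fix e :: real assume e: "0 < e"
    obtain n :: nat where n: "2 / e < real n" using reals_Archimedean2 by blast
    moreover have "0 < 2 / e" using e by simp
    ultimately have n0: "n > 0" by (metis less_trans of_nat_0_less_iff)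
    with n e have "2 / real n \<le> e" by (simp add: field_simps)
    with bound[OF n0] show "\<bar>integral\<^sup>L M \<psi> - integral\<^sup>L N \<psi>\<bar> \<le> tv_dist M N + e" by linarith
  qed
qed

lemma tv_dist_integral:
  fixes \<phi> :: "real \<times> real \<Rightarrow> real"
  assumes M: "M \<in> PK" and N: "N \<in> PK" and \<phi>: "continuous_on KK \<phi>"
    and B: "0 < B" "\<And>z. z \<in> KK \<Longrightarrow> \<bar>\<phi> z\<bar> \<le> B"
  shows "\<bar>integral\<^sup>L M \<phi> - integral\<^sup>L N \<phi>\<bar> \<le> 2 * B * tv_dist M N"
proof -
  define \<psi> where "\<psi> z = \<phi> z / (2 * B) + 1 / 2" for z
  have c: "continuous_on KK \<psi>" unfolding \<psi>_def by (intro continuous_intros \<phi>) (use B in auto)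
  have r: "0 \<le> \<psi> z \<and> \<psi> z \<le> 1" if "z \<in> KK" for z
    using B(1) B(2)[OF that] by (auto simp: \<psi>_def field_simps abs_le_iff)
  have eq: "integral\<^sup>L Q \<psi> = integral\<^sup>L Q \<phi> / (2 * B) + 1 / 2" if Q: "Q \<in> PK" for Q
  proof -
    interpret prob_space Q by (rule PK_prob[OF Q])
    show ?thesis unfolding \<psi>_def
      using PK_integrable[OF Q \<phi>] by (simp add: prob_space)
  qed
  have "\<bar>integral\<^sup>L M \<phi> - integral\<^sup>L N \<phi>\<bar> / (2 * B) \<le> tv_dist M N"
    using tv_dist_integral_unit[OF M N c r] B(1)
    by (simp add: eq M N diff_divide_distrib[symmetric])
  with B(1) show ?thesis by (simp add: field_simps)
qed

lemma tv_continuous_integral_at_0: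
  fixes \<phi> :: "real \<times> real \<Rightarrow> real"
  assumes g: "tv_continuous_from_0 g" "\<And>t. t \<ge> 0 \<Longrightarrow> g t \<in> PK" and \<phi>: "continuous_on KK \<phi>"
  shows "((\<lambda>s. integral\<^sup>L (g s) \<phi>) \<longlongrightarrow> integral\<^sup>L (g 0) \<phi>) (at 0 within {0..})"
proof -
  obtain B0 where B0: "0 \<le> B0" "\<And>z. z \<in> KK \<Longrightarrow> \<bar>\<phi> z\<bar> \<le> B0"
    using continuous_on_KK_bounded[OF \<phi>] by blast
  define B where "B = B0 + 1"
  have B: "0 < B" "\<And>z. z \<in> KK \<Longrightarrow> \<bar>\<phi> z\<bar> \<le> B" using B0 by (force simp: B_def)+
  have "((\<lambda>s. integral\<^sup>L (g s) \<phi> - integral\<^sup>L (g 0) \<phi>) \<longlongrightarrow> 0) (at 0 within {0..})"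
  proof (rule Lim_null_comparison)
    show "\<forall>\<^sub>F s in at 0 within {0..}. norm (integral\<^sup>L (g s) \<phi> - integral\<^sup>L (g 0) \<phi>)
        \<le> 2 * B * tv_dist (g s) (g 0)"
      unfolding eventually_at_filter
      by (rule always_eventually) (auto intro!: tv_dist_integral g(2) \<phi> B)
    have "((\<lambda>s. tv_dist (g s) (g 0)) \<longlongrightarrow> 0) (at 0 within {0..})"
      using g(1) by (auto simp: tv_continuous_from_0_def)
    from tendsto_mult_right_zero[OF this]
    show "((\<lambda>s. 2 * B * tv_dist (g s) (g 0)) \<longlongrightarrow> 0) (at 0 within {0..})" .
  qed
  then show ?thesis by (simp add: LIM_zero_iff)
qed

lemma abs_kern_le:
  assumes p: "p \<in> {0..1}" and \<gamma>: "\<gamma> \<in> {0<..<1}" and \<phi>: "L-lipschitz_on KK \<phi>"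
    and z: "z \<in> KK" and zs: "zs \<in> KK"
  shows "\<bar>kern p \<gamma> \<phi> z zs\<bar> \<le> 2 * \<gamma> * L"
proof -
  obtain w h ws hs where zz: "z = (w, h)" "zs = (ws, hs)" by (cases z, cases zs)
  from z zs have r: "-1 \<le> w" "w \<le> 1" "0 \<le> h" "h \<le> 1" "-1 \<le> ws" "ws \<le> 1" "0 \<le> hs" "hs \<le> 1"
    by (auto simp: zz KK_def)
  have L: "0 \<le> L" by (rule lipschitz_on_nonneg[OF \<phi>])
  have "w + \<gamma> * (ws - w) = (1 - \<gamma>) *\<^sub>R w + \<gamma> *\<^sub>R ws" by (simp add: algebra_simps)
  also have "\<dots> \<in> {-1..1}"
    by (rule convexD[OF convex_real_interval(5)]) (use r \<gamma> in auto)
  finally have mem: "(w + \<gamma> * (ws - w), h) \<in> KK"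
    using r by (simp add: KK_def)
  have "\<bar>\<phi> (w + \<gamma> * (ws - w), h) - \<phi> (w, h)\<bar> \<le> L * dist (w + \<gamma> * (ws - w), h) (w, h)"
    using lipschitz_onD[OF \<phi> mem z[unfolded zz]] by (simp add: dist_real_def)
  also have "dist (w + \<gamma> * (ws - w), h) (w, h) = \<gamma> * \<bar>ws - w\<bar>"
    using \<gamma> by (simp add: dist_Pair_Pair dist_real_def abs_mult)
  also have "L * (\<gamma> * \<bar>ws - w\<bar>) \<le> L * (\<gamma> * 2)"
    by (intro mult_left_mono) (use L \<gamma> r in auto)
  finally have 1: "\<bar>\<phi> (w + \<gamma> * (ws - w), h) - \<phi> (w, h)\<bar> \<le> 2 * \<gamma> * L" by (simp add: ac_simps)
  have 2: "\<bar>p + (1 - p) * (if snd zs \<ge> snd z then 1 else 0)\<bar> \<le> 1" using p by auto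
  have "\<bar>kern p \<gamma> \<phi> z zs\<bar> \<le> (2 * \<gamma> * L) * 1"
    unfolding kern_def abs_mult by (rule mult_mono) (use 1 2 L \<gamma> in \<open>auto simp: zz\<close>)
  then show ?thesis by simp
qed

lemma abs_rhs_le:
  assumes p: "p \<in> {0..1}" and \<alpha>: "\<alpha> \<in> {0..1}" and \<gamma>: "\<gamma> \<in> {0<..<1}"
    and \<phi>: "L-lipschitz_on KK \<phi>" and M: "M \<in> PK" and N: "N \<in> PK"
  shows "\<bar>rhs p \<alpha> \<gamma> M N \<phi>\<bar> \<le> 2 * \<gamma> * L"
proof -
  interpret M: prob_space M by (rule PK_prob[OF M])
  interpret N: prob_space N by (rule PK_prob[OF N])
  have C: "0 \<le> 2 * \<gamma> * L" using lipschitz_on_nonneg[OF \<phi>] \<gamma> by simp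
  show ?thesis unfolding rhs_def
  proof (rule N.abs_integral_le_const[OF C])
    fix z assume "z \<in> space N"
    then have z: "z \<in> KK" by (simp add: PK_space[OF N])
    have "\<bar>\<integral>zs. kern p \<gamma> \<phi> z zs \<partial>M\<bar> \<le> 2 * \<gamma> * L"
      by (rule M.abs_integral_le_const[OF C]) (simp add: PK_space[OF M] abs_kern_le[OF p \<gamma> \<phi> z])
    moreover have "\<bar>\<integral>zs. kern p \<gamma> \<phi> z zs \<partial>N\<bar> \<le> 2 * \<gamma> * L"
      by (rule N.abs_integral_le_const[OF C]) (simp add: PK_space[OF N] abs_kern_le[OF p \<gamma> \<phi> z])
    ultimately have "\<bar>\<alpha> * (\<integral>zs. kern p \<gamma> \<phi> z zs \<partial>M)\<bar> + \<bar>(1 - \<alpha>) * (\<integral>zs. kern p \<gamma> \<phi> z zs \<partial>N)\<bar>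
        \<le> \<alpha> * (2 * \<gamma> * L) + (1 - \<alpha>) * (2 * \<gamma> * L)"
      unfolding abs_mult using \<alpha> by (intro add_mono mult_mono) auto
    then show "\<bar>\<alpha> * (\<integral>zs. kern p \<gamma> \<phi> z zs \<partial>M) + (1 - \<alpha>) * (\<integral>zs. kern p \<gamma> \<phi> z zs \<partial>N)\<bar> \<le> 2 * \<gamma> * L"
      by (simp add: algebra_simps)
  qed
qed

lemma solution_lipschitz_in_time:
  fixes g :: "real \<Rightarrow> (real \<times> real) measure"
  assumes p: "p \<in> {0..1}" and \<alpha>: "\<alpha> \<in> {0..1}" and \<gamma>: "\<gamma> \<in> {0<..<1}" and M: "M \<in> PK"
    and g: "\<And>t. t \<ge> 0 \<Longrightarrow> g t \<in> PK" "tv_continuous_from_0 g"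
    and eqn: "\<And>\<phi> t. continuous_on KK \<phi> \<Longrightarrow> t > 0 \<Longrightarrow>
        ((\<lambda>s. integral\<^sup>L (g s) \<phi>) has_real_derivative rhs p \<alpha> \<gamma> M (g t) \<phi>) (at t)"
    and \<phi>: "L-lipschitz_on KK \<phi>" and st: "0 \<le> s" "s \<le> t"
  shows "\<bar>integral\<^sup>L (g t) \<phi> - integral\<^sup>L (g s) \<phi>\<bar> \<le> 2 * \<gamma> * L * (t - s)"
proof (cases "s = t")
  case False
  define u where "u t = integral\<^sup>L (g t) \<phi>" for t
  have c: "continuous_on KK \<phi>" by (rule lipschitz_on_continuous_on[OF \<phi>])
  have D: "(u has_real_derivative rhs p \<alpha> \<gamma> M (g x) \<phi>) (at x)" if "x > 0" for x
    unfolding u_def by (rule eqn[OF c that])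
  have cont: "continuous_on {0..} u"
    unfolding continuous_on_def
  proof
    fix x :: real assume "x \<in> {0..}"
    then consider "x = 0" | "x > 0" by fastforce
    then show "(u \<longlongrightarrow> u x) (at x within {0..})"
    proof cases
      case 1 then show ?thesis
        unfolding u_def using tv_continuous_integral_at_0[OF g(2,1) c] by simp
    next
      case 2
      have "isCont u x" by (rule DERIV_isCont[OF D[OF 2]])
      then show ?thesis
        unfolding isCont_def by (rule tendsto_within_subset) auto
    qed
  qed
  obtain x where x: "s < x" "x < t" "u t - u s = rhs p \<alpha> \<gamma> M (g x) \<phi> * (t - s)"
  proof (rule mvt[of s t u "\<lambda>x y. rhs p \<alpha> \<gamma> M (g x) \<phi> * y"])
    show "s < t" using False st by simp
    show "continuous_on {s..t} u" by (rule continuous_on_subset[OF cont]) (use st in auto)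
    show "(u has_derivative (\<lambda>y. rhs p \<alpha> \<gamma> M (g x) \<phi> * y)) (at x)" if "s < x" "x < t" for x
      using D[of x] st that by (simp add: has_field_derivative_def)
  qed auto
  have "\<bar>rhs p \<alpha> \<gamma> M (g x) \<phi>\<bar> \<le> 2 * \<gamma> * L"
    by (rule abs_rhs_le[OF p \<alpha> \<gamma> \<phi> M g(1)]) (use x st in auto)
  then have "\<bar>u t - u s\<bar> \<le> 2 * \<gamma> * L * (t - s)"
    unfolding x(3) abs_mult using st by (simp add: mult_right_mono)
  then show ?thesis by (simp add: u_def)
qed simp

subsection \<open>Compactness of curves of measures\<close>

lemma lipschitz_dense_in_continuous:
  fixes \<phi> :: "real \<times> real \<Rightarrow> real"
  assumes \<phi>: "continuous_on KK \<phi>" and e: "0 < e"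
  obtains L \<psi> where "L-lipschitz_on KK \<psi>" "\<And>z. z \<in> KK \<Longrightarrow> \<bar>\<phi> z - \<psi> z\<bar> < e"
proof -
  define R where "R = {\<psi> :: real \<times> real \<Rightarrow> real. \<exists>L. L-lipschitz_on KK \<psi>}"
  interpret function_ring_on R KK
  proof
    show "compact KK" by (rule KK_compact)
    show "continuous_on KK f" if "f \<in> R" for f
      using that by (auto simp: R_def intro: lipschitz_on_continuous_on)
    show "(\<lambda>x. f x + g x) \<in> R" if "f \<in> R" "g \<in> R" for f g
      using that by (auto simp: R_def intro: lipschitz_on_add)
    show "(\<lambda>_. c) \<in> R" for c
      using lipschitz_on_constant by (auto simp: R_def)
    show "\<exists>f\<in>R. f x \<noteq> f y" if "x \<noteq> y" for x y
    proof (rule bexI[of _ "\<lambda>z. dist x z"])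
      have "1-lipschitz_on KK (\<lambda>z. dist x z)"
        by (rule lipschitz_onI)
           (simp_all add: dist_real_def abs_le_iff, metis dist_commute dist_triangle add.commute diff_le_eq)
      then show "(\<lambda>z. dist x z) \<in> R" by (auto simp: R_def)
      show "dist x x \<noteq> dist x y" using that by simp
    qed
    show "(\<lambda>x. f x * g x) \<in> R" if fg: "f \<in> R" "g \<in> R" for f g
    proof -
      from fg obtain L1 L2 where L: "L1-lipschitz_on KK f" "L2-lipschitz_on KK g"
        by (auto simp: R_def)
      obtain A where A: "0 \<le> A" "\<And>z. z \<in> KK \<Longrightarrow> \<bar>f z\<bar> \<le> A"
        using continuous_on_KK_bounded[OF lipschitz_on_continuous_on[OF L(1)]] by blast
      obtain B where B: "0 \<le> B" "\<And>z. z \<in> KK \<Longrightarrow> \<bar>g z\<bar> \<le> B"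
        using continuous_on_KK_bounded[OF lipschitz_on_continuous_on[OF L(2)]] by blast
      have "(A * L2 + L1 * B)-lipschitz_on KK (\<lambda>x. f x * g x)"
      proof (rule lipschitz_onI)
        show "0 \<le> A * L2 + L1 * B"
          using A(1) B(1) L[THEN lipschitz_on_nonneg] by simp
        fix x y assume xy: "x \<in> KK" "y \<in> KK"
        have "\<bar>f x * g x - f y * g y\<bar> = \<bar>f x * (g x - g y) + (f x - f y) * g y\<bar>"
          by (simp add: algebra_simps)
        also have "\<dots> \<le> \<bar>f x\<bar> * \<bar>g x - g y\<bar> + \<bar>f x - f y\<bar> * \<bar>g y\<bar>"
          by (metis abs_mult abs_triangle_ineq)
        also have "\<dots> \<le> A * (L2 * dist x y) + (L1 * dist x y) * B"
          using lipschitz_onD[OF L(1) xy] lipschitz_onD[OF L(2) xy] A B xy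
            L[THEN lipschitz_on_nonneg]
          by (intro add_mono mult_mono) (auto simp: dist_real_def)
        finally show "dist (f x * g x) (f y * g y) \<le> (A * L2 + L1 * B) * dist x y"
          by (simp add: dist_real_def algebra_simps)
      qed
      then show ?thesis by (auto simp: R_def)
    qed
  qed
  from Stone_Weierstrass_basic[OF \<phi> e] that show thesis by (auto simp: R_def)
qed

lemma lipschitz_on_pointwise_limit:
  fixes F :: "nat \<Rightarrow> 'a::metric_space \<Rightarrow> 'b::metric_space"
  assumes "\<And>n. L-lipschitz_on S (F n)" "\<And>x. x \<in> S \<Longrightarrow> (\<lambda>n. F n x) \<longlonglongrightarrow> G x"
  shows "L-lipschitz_on S G"
proof (rule lipschitz_onI)
  show "0 \<le> L" by (rule lipschitz_on_nonneg[OF assms(1)])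
  fix x y assume xy: "x \<in> S" "y \<in> S"
  show "dist (G x) (G y) \<le> L * dist x y"
    by (rule LIMSEQ_le_const2[OF tendsto_dist[OF assms(2)[OF xy(1)] assms(2)[OF xy(2)]]])
       (use lipschitz_onD[OF assms(1) xy] in blast)
qed

locale equilipschitz_curves =
  fixes g :: "nat \<Rightarrow> real \<Rightarrow> (real \<times> real) measure" and C :: real
  assumes in_PK: "\<tau> \<ge> 0 \<Longrightarrow> g n \<tau> \<in> PK"
    and time_lipschitz: "L-lipschitz_on KK \<phi> \<Longrightarrow> 0 \<le> \<sigma> \<Longrightarrow> 0 \<le> \<tau> \<Longrightarrow>
      \<bar>integral\<^sup>L (g n \<tau>) \<phi> - integral\<^sup>L (g n \<sigma>) \<phi>\<bar> \<le> C * L * \<bar>\<tau> - \<sigma>\<bar>"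
begin

lemma subsequence_on_dense_times:
  obtains r :: "nat \<Rightarrow> nat" where "strict_mono r"
    "\<And>q (\<phi> :: real \<times> real \<Rightarrow> real). 0 \<le> q \<Longrightarrow> q \<in> \<rat> \<Longrightarrow> continuous_on KK \<phi> \<Longrightarrow> convergent (\<lambda>n. integral\<^sup>L (g (r n) q) \<phi>)"
proof -
  define q :: "nat \<Rightarrow> real" where "q = from_nat_into (\<rat> \<inter> {0..})"
  have ne: "\<rat> \<inter> {0..} \<noteq> ({} :: real set)" using Rats_0 by fastforce
  have q0: "0 \<le> q n" for n
    using from_nat_into[OF ne, of n] by (simp add: q_def)
  define P where "P n s \<longleftrightarrow> (\<forall>\<phi> :: real \<times> real \<Rightarrow> real. continuous_on KK \<phi> \<longrightarrow> convergent (\<lambda>k. integral\<^sup>L (g (s k) (q n)) \<phi>))"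
    for n and s :: "nat \<Rightarrow> nat"
  interpret subseqs P
  proof
    fix n and s :: "nat \<Rightarrow> nat" assume "strict_mono s"
    obtain r N where "strict_mono r" "N \<in> PK"
      "\<And>\<phi>::real \<times> real \<Rightarrow> real. continuous_on KK \<phi> \<Longrightarrow>
        (\<lambda>k. integral\<^sup>L (g (s (r k)) (q n)) \<phi>) \<longlonglongrightarrow> integral\<^sup>L N \<phi>"
      using PK_sequentially_compact[of "\<lambda>k. g (s k) (q n)"] in_PK q0 by blast
    then show "\<exists>r'. strict_mono r' \<and> P n (s \<circ> r')"
      by (intro exI[of _ r]) (auto simp: P_def convergent_def)
  qed
  have P_diag: "P k (diagseq \<circ> (+) (Suc k))" for k
  proof (rule diagseq_holds)
    fix r s :: "nat \<Rightarrow> nat" and n assume "strict_mono r" "P n s"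
    then show "P n (s \<circ> r)"
      unfolding P_def using convergent_subseq_convergent[of "\<lambda>k. integral\<^sup>L (g (s k) (q n)) _" r]
      by (auto simp: o_def)
  qed
  have conv: "convergent (\<lambda>n. integral\<^sup>L (g (diagseq n) (q k)) \<phi>)"
    if \<phi>: "continuous_on KK \<phi>" for k and \<phi> :: "real \<times> real \<Rightarrow> real"
  proof -
    have "convergent (\<lambda>n. integral\<^sup>L (g (diagseq (Suc k + n)) (q k)) \<phi>)"
      using P_diag[of k] \<phi> unfolding P_def o_def by blast
    then have "convergent (\<lambda>n. integral\<^sup>L (g (diagseq (n + Suc k)) (q k)) \<phi>)"
      by (simp only: add.commute[of "Suc k"])
    then show ?thesis
      by (rule convergent_ignore_initial_segment[THEN iffD1])
  qed
  show thesis
  proof (rule that[OF subseq_diagseq])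
    fix x :: real and \<phi> :: "real \<times> real \<Rightarrow> real"
    assume x: "0 \<le> x" "x \<in> \<rat>" and \<phi>: "continuous_on KK \<phi>"
    have "countable (\<rat> \<inter> {0..} :: real set)" using countable_rat by blast
    with x obtain k where "q k = x"
      unfolding q_def using from_nat_into_surj[of "\<rat> \<inter> {0..}" x] by auto
    with conv[OF \<phi>, of k] show "convergent (\<lambda>n. integral\<^sup>L (g (diagseq n) x) \<phi>)" by simp
  qed
qed

lemma subsequence_at_all_times:
  obtains r :: "nat \<Rightarrow> nat" and \<nu> where "strict_mono r" "\<And>\<tau>. 0 \<le> \<tau> \<Longrightarrow> \<nu> \<tau> \<in> PK"
    "\<And>\<tau> L (\<phi> :: real \<times> real \<Rightarrow> real). 0 \<le> \<tau> \<Longrightarrow> L-lipschitz_on KK \<phi> \<Longrightarrow>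
      (\<lambda>n. integral\<^sup>L (g (r n) \<tau>) \<phi>) \<longlonglongrightarrow> integral\<^sup>L (\<nu> \<tau>) \<phi>"
proof -
  obtain r where r: "strict_mono r"
    and conv: "\<And>q (\<phi> :: real \<times> real \<Rightarrow> real). 0 \<le> q \<Longrightarrow> q \<in> \<rat> \<Longrightarrow> continuous_on KK \<phi> \<Longrightarrow> convergent (\<lambda>n. integral\<^sup>L (g (r n) q) \<phi>)"
    using subsequence_on_dense_times by blast
  have conv_all: "convergent (\<lambda>n. integral\<^sup>L (g (r n) \<tau>) \<phi>)"
    if \<tau>: "0 \<le> \<tau>" and \<phi>: "L-lipschitz_on KK \<phi>" for \<tau> L and \<phi> :: "real \<times> real \<Rightarrow> real"
  proof -
    have "Cauchy (\<lambda>n. integral\<^sup>L (g (r n) \<tau>) \<phi>)"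
    proof (rule metric_CauchyI)
      fix e :: real assume e: "0 < e"
      define D where "D = \<bar>C * L\<bar> + 1"
      have D: "D > 0" "C * L \<le> D" by (auto simp: D_def)
      obtain q where q: "q \<in> \<rat>" "\<tau> < q" "q < \<tau> + e / (3 * D)"
        using Rats_dense_in_real[of \<tau> "\<tau> + e / (3 * D)"] e D(1) by auto
      have close: "\<bar>integral\<^sup>L (g n \<tau>) \<phi> - integral\<^sup>L (g n q) \<phi>\<bar> < e / 3" for n
      proof -
        have "\<bar>integral\<^sup>L (g n \<tau>) \<phi> - integral\<^sup>L (g n q) \<phi>\<bar> \<le> C * L * \<bar>\<tau> - q\<bar>"
          using time_lipschitz[OF \<phi>, of q \<tau> n] \<tau> q by linarith
        also have "\<dots> \<le> D * (q - \<tau>)"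
          using q D by (simp add: mult_right_mono)
        also have "\<dots> < D * (e / (3 * D))"
          using q D by (intro mult_strict_left_mono) auto
        also have "\<dots> = e / 3" using D by simp
        finally show ?thesis .
      qed
      have "Cauchy (\<lambda>n. integral\<^sup>L (g (r n) q) \<phi>)"
        using conv[of q \<phi>] \<tau> q lipschitz_on_continuous_on[OF \<phi>] by (simp add: Cauchy_convergent_iff)
      then obtain N where N: "\<And>m n. m \<ge> N \<Longrightarrow> n \<ge> N \<Longrightarrow>
          dist (integral\<^sup>L (g (r m) q) \<phi>) (integral\<^sup>L (g (r n) q) \<phi>) < e / 3"
        using metric_CauchyD[of "\<lambda>n. integral\<^sup>L (g (r n) q) \<phi>" "e / 3"] e by auto
      have "dist (integral\<^sup>L (g (r m) \<tau>) \<phi>) (integral\<^sup>L (g (r n) \<tau>) \<phi>) < e" if "m \<ge> N" "n \<ge> N" for m n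
        using N[OF that] close[of "r m"] close[of "r n"] unfolding dist_real_def by argo
      then show "\<exists>N. \<forall>m\<ge>N. \<forall>n\<ge>N. dist (integral\<^sup>L (g (r m) \<tau>) \<phi>) (integral\<^sup>L (g (r n) \<tau>) \<phi>) < e"
        by blast
    qed
    then show ?thesis by (simp add: Cauchy_convergent_iff)
  qed
  have "\<exists>N. N \<in> PK \<and> (\<forall>L (\<phi> :: real \<times> real \<Rightarrow> real). L-lipschitz_on KK \<phi> \<longrightarrow>
      (\<lambda>n. integral\<^sup>L (g (r n) \<tau>) \<phi>) \<longlonglongrightarrow> integral\<^sup>L N \<phi>)" if \<tau>: "0 \<le> \<tau>" for \<tau>
  proof -
    obtain s N where s: "strict_mono s" and N: "N \<in> PK" and
      lim: "\<And>\<phi>::real \<times> real \<Rightarrow> real. continuous_on KK \<phi> \<Longrightarrow>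
        (\<lambda>k. integral\<^sup>L (g (r (s k)) \<tau>) \<phi>) \<longlonglongrightarrow> integral\<^sup>L N \<phi>"
      using PK_sequentially_compact[of "\<lambda>k. g (r k) \<tau>"] in_PK \<tau> by blast
    have "(\<lambda>n. integral\<^sup>L (g (r n) \<tau>) \<phi>) \<longlonglongrightarrow> integral\<^sup>L N \<phi>"
      if \<phi>: "L-lipschitz_on KK \<phi>" for L and \<phi> :: "real \<times> real \<Rightarrow> real"
    proof -
      obtain l where l: "(\<lambda>n. integral\<^sup>L (g (r n) \<tau>) \<phi>) \<longlonglongrightarrow> l"
        using conv_all[OF \<tau> \<phi>] by (auto simp: convergent_def)
      from LIMSEQ_subseq_LIMSEQ[OF l s] lim[OF lipschitz_on_continuous_on[OF \<phi>]]
      have "l = integral\<^sup>L N \<phi>" by (auto simp: o_def intro: LIMSEQ_unique)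
      with l show ?thesis by simp
    qed
    with N show ?thesis by blast
  qed
  then obtain \<nu> where "\<And>\<tau>. 0 \<le> \<tau> \<Longrightarrow> \<nu> \<tau> \<in> PK \<and> (\<forall>L (\<phi> :: real \<times> real \<Rightarrow> real). L-lipschitz_on KK \<phi> \<longrightarrow>
      (\<lambda>n. integral\<^sup>L (g (r n) \<tau>) \<phi>) \<longlonglongrightarrow> integral\<^sup>L (\<nu> \<tau>) \<phi>)"
    by metis
  with that[OF r, of \<nu>] show thesis by blast
qed

end

lemma weak_continuous_if_time_lipschitz:
  assumes \<nu>: "\<And>\<tau>. 0 \<le> \<tau> \<Longrightarrow> \<nu> \<tau> \<in> PK"
    and lip: "\<And>L \<phi> \<sigma> \<tau>. L-lipschitz_on KK \<phi> \<Longrightarrow> 0 \<le> \<sigma> \<Longrightarrow> 0 \<le> \<tau> \<Longrightarrow>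
      \<bar>integral\<^sup>L (\<nu> \<tau>) \<phi> - integral\<^sup>L (\<nu> \<sigma>) \<phi>\<bar> \<le> C * L * \<bar>\<tau> - \<sigma>\<bar>"
  shows "weak_continuous_from_0 \<nu>"
  unfolding weak_continuous_from_0_def
proof (intro allI impI)
  fix \<phi> :: "real \<times> real \<Rightarrow> real" assume \<phi>: "continuous_on KK \<phi>"
  show "continuous_on {0..} (\<lambda>t. integral\<^sup>L (\<nu> t) \<phi>)"
    unfolding continuous_on_iff
  proof (intro ballI allI impI)
    fix \<sigma> e :: real assume \<sigma>: "\<sigma> \<in> {0..}" and e: "0 < e"
    obtain L \<psi> where \<psi>: "L-lipschitz_on KK \<psi>" "\<And>z. z \<in> KK \<Longrightarrow> \<bar>\<phi> z - \<psi> z\<bar> < e / 3"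
      using lipschitz_dense_in_continuous[OF \<phi>, of "e / 3"] e by auto
    have close: "\<bar>integral\<^sup>L (\<nu> \<tau>) \<phi> - integral\<^sup>L (\<nu> \<tau>) \<psi>\<bar> \<le> e / 3" if "0 \<le> \<tau>" for \<tau>
      by (rule PK_integral_close[OF \<nu>[OF that] \<phi> lipschitz_on_continuous_on[OF \<psi>(1)]])
         (use e \<psi>(2) in \<open>auto intro: less_imp_le\<close>)
    define D where "D = \<bar>C * L\<bar> + 1"
    have D: "D > 0" "C * L \<le> D" by (auto simp: D_def)
    have "dist (integral\<^sup>L (\<nu> \<tau>) \<phi>) (integral\<^sup>L (\<nu> \<sigma>) \<phi>) < e"
      if \<tau>: "\<tau> \<in> {0..}" "dist \<tau> \<sigma> < e / (3 * D)" for \<tau>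
    proof -
      have "\<bar>integral\<^sup>L (\<nu> \<tau>) \<psi> - integral\<^sup>L (\<nu> \<sigma>) \<psi>\<bar> \<le> C * L * \<bar>\<tau> - \<sigma>\<bar>"
        using lip[OF \<psi>(1)] \<sigma> \<tau> by simp
      also have "\<dots> \<le> D * \<bar>\<tau> - \<sigma>\<bar>"
        using D by (simp add: mult_right_mono)
      also have "\<dots> < D * (e / (3 * D))"
        using \<tau> D by (intro mult_strict_left_mono) (auto simp: dist_real_def)
      also have "\<dots> = e / 3" using D by simp
      finally show ?thesis
        using close[of \<sigma>] close[of \<tau>] \<sigma> \<tau>(1) unfolding dist_real_def atLeast_iff by argo
    qed
    then show "\<exists>d>0. \<forall>\<tau>\<in>{0..}. dist \<tau> \<sigma> < d \<longrightarrow>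
        dist (integral\<^sup>L (\<nu> \<tau>) \<phi>) (integral\<^sup>L (\<nu> \<sigma>) \<phi>) < e"
      using e D by (intro exI[of _ "e / (3 * D)"]) auto
  qed
qed

lemma abs_diff_le_2_of_lipschitz:
  assumes "1-lipschitz_on KK (\<phi> :: real \<times> real \<Rightarrow> real)" "z \<in> KK"
  shows "\<bar>\<phi> z - \<phi> (0, 0)\<bar> \<le> 2"
proof -
  obtain w h where z: "z = (w, h)" by (cases z)
  have "\<bar>\<phi> z - \<phi> (0, 0)\<bar> \<le> dist z (0, 0)"
    using lipschitz_onD[OF assms(1,2), of "(0, 0)"] by (simp add: dist_real_def KK_def)
  also have "\<dots> \<le> \<bar>w\<bar> + \<bar>h\<bar>"
    using sqrt_sum_squares_le_sum_abs[of w h] by (simp add: z dist_Pair_Pair dist_real_def)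
  also have "\<dots> \<le> 2" using assms(2) by (auto simp: z KK_def)
  finally show ?thesis .
qed

lemma W1_bounds:
  assumes e: "\<And>\<phi>::real \<times> real \<Rightarrow> real. 1-lipschitz_on KK \<phi> \<Longrightarrow> integral\<^sup>L M \<phi> - integral\<^sup>L N \<phi> \<le> e"
  shows "0 \<le> W1 M N" "W1 M N \<le> e"
proof -
  have lip0: "1-lipschitz_on KK (\<lambda>_. 0 :: real)"
    using lipschitz_on_mono[OF lipschitz_on_constant, of KK KK 1] by simp
  then have mem: "0 \<in> {integral\<^sup>L M \<phi> - integral\<^sup>L N \<phi> | \<phi> :: real \<times> real \<Rightarrow> real. 1-lipschitz_on KK \<phi>}"
    by force
  show "W1 M N \<le> e"
    unfolding W1_def by (rule cSup_least) (use mem e in auto)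
  show "0 \<le> W1 M N"
    unfolding W1_def by (rule cSup_upper[OF mem]) (use e in \<open>auto intro!: bdd_aboveI[of _ e]\<close>)
qed

context equilipschitz_curves
begin

text \<open>A failure of uniformity would produce times and test functions which, by compactness of
  the time interval and Arzela--Ascoli, could be replaced by fixed ones.\<close>

lemma uniform_over_lipschitz_and_time:
  fixes e :: real
  assumes \<nu>: "\<And>\<tau>. 0 \<le> \<tau> \<Longrightarrow> \<nu> \<tau> \<in> PK"
    and lim: "\<And>\<tau> (\<phi> :: real \<times> real \<Rightarrow> real). 0 \<le> \<tau> \<Longrightarrow> 1-lipschitz_on KK \<phi> \<Longrightarrow>
      (\<lambda>n. integral\<^sup>L (g (r n) \<tau>) \<phi>) \<longlonglongrightarrow> integral\<^sup>L (\<nu> \<tau>) \<phi>"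
    and lip: "\<And>\<phi> \<sigma> \<tau>. 1-lipschitz_on KK \<phi> \<Longrightarrow> 0 \<le> \<sigma> \<Longrightarrow> 0 \<le> \<tau> \<Longrightarrow>
      \<bar>integral\<^sup>L (\<nu> \<tau>) \<phi> - integral\<^sup>L (\<nu> \<sigma>) \<phi>\<bar> \<le> C * \<bar>\<tau> - \<sigma>\<bar>"
    and e: "0 < e"
  shows "\<exists>N. \<forall>n\<ge>N. \<forall>\<tau>\<in>{0..T}. \<forall>\<phi>. 1-lipschitz_on KK \<phi> \<longrightarrow>
    integral\<^sup>L (g (r n) \<tau>) \<phi> - integral\<^sup>L (\<nu> \<tau>) \<phi> \<le> e"
proof (rule ccontr)
  assume "\<not> ?thesis"
  define bad where "bad N n \<tau> \<phi> \<longleftrightarrow> N \<le> n \<and> \<tau> \<in> {0..T} \<and> 1-lipschitz_on KK \<phi> \<and>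
      \<not> integral\<^sup>L (g (r n) \<tau>) \<phi> - integral\<^sup>L (\<nu> \<tau>) \<phi> \<le> e" for N n \<tau> \<phi>
  from \<open>\<not> ?thesis\<close> have "\<forall>N. \<exists>n \<tau> \<phi>. bad N n \<tau> \<phi>"
    unfolding bad_def by blast
  then obtain n \<tau> \<phi> where bad: "\<And>N. bad N (n N) (\<tau> N) (\<phi> N)"
    by metis
  then have n: "\<And>N. n N \<ge> N" and \<tau>: "\<And>N. \<tau> N \<in> {0..T}"
    and \<phi>: "\<And>N. 1-lipschitz_on KK (\<phi> N)"
    and gap: "\<And>N. integral\<^sup>L (g (r (n N)) (\<tau> N)) (\<phi> N) - integral\<^sup>L (\<nu> (\<tau> N)) (\<phi> N) > e"
    by (simp_all add: bad_def not_le)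
  define \<psi> where "\<psi> N z = \<phi> N z - \<phi> N (0, 0)" for N z
  have \<psi>_lip: "1-lipschitz_on KK (\<psi> N)" for N
    using lipschitz_on_diff[OF \<phi> lipschitz_on_constant] by (simp add: \<psi>_def)
  have \<psi>_int: "integral\<^sup>L M (\<psi> N) = integral\<^sup>L M (\<phi> N) - \<phi> N (0, 0)" if M: "M \<in> PK" for M N
  proof -
    interpret prob_space M by (rule PK_prob[OF M])
    show ?thesis
      unfolding \<psi>_def using PK_integrable[OF M lipschitz_on_continuous_on[OF \<phi>]]
      by (simp add: prob_space)
  qed
  have \<tau>0: "0 \<le> \<tau> N" for N using \<tau>[of N] by simp
  have gap': "integral\<^sup>L (g (r (n N)) (\<tau> N)) (\<psi> N) - integral\<^sup>L (\<nu> (\<tau> N)) (\<psi> N) > e" for N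
    using gap[of N] by (simp add: \<psi>_int in_PK \<nu> \<tau>0)
  obtain \<psi>' k where k: "strict_mono (k :: nat \<Rightarrow> nat)" and
    unif: "\<And>e. 0 < e \<Longrightarrow> \<exists>N. \<forall>n x. n \<ge> N \<and> x \<in> KK \<longrightarrow> norm (\<psi> (k n) x - \<psi>' x) < e"
  proof (rule Arzela_Ascoli[OF KK_compact, of \<psi> 2])
    show "norm (\<psi> N z) \<le> 2" if "z \<in> KK" for N z
      using abs_diff_le_2_of_lipschitz[OF \<phi> that] by (simp add: \<psi>_def)
    show "\<exists>d>0. \<forall>n y. y \<in> KK \<and> norm (x - y) < d \<longrightarrow> norm (\<psi> n x - \<psi> n y) < e"
      if "x \<in> KK" "0 < e" for x e
    proof (intro exI[of _ e] conjI allI impI that(2))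
      fix n y assume "y \<in> KK \<and> norm (x - y) < e"
      with lipschitz_on_normD[OF \<psi>_lip \<open>x \<in> KK\<close>, of y n]
      show "norm (\<psi> n x - \<psi> n y) < e" by simp
    qed
  qed blast
  have "(\<lambda>N. \<psi> (k N) z) \<longlonglongrightarrow> \<psi>' z" if "z \<in> KK" for z
    unfolding LIMSEQ_iff using unif that by meson
  then have \<psi>'_lip: "1-lipschitz_on KK \<psi>'"
    by (rule lipschitz_on_pointwise_limit[where F = "\<lambda>N. \<psi> (k N)", OF \<psi>_lip])
  have "seq_compact {0..T}" using compact_imp_seq_compact[of "{0..T}"] by simp
  then obtain \<tau>' l where \<tau>': "\<tau>' \<in> {0..T}" and l: "strict_mono l" and \<tau>_lim: "(\<lambda>N. \<tau> (k (l N))) \<longlonglongrightarrow> \<tau>'"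
    by (rule seq_compactE[where f = "\<lambda>N. \<tau> (k N)"]) (use \<tau> in \<open>auto simp: o_def\<close>)
  define m where "m N = k (l N)" for N
  have \<tau>'0: "0 \<le> \<tau>'" using \<tau>' by simp
  have "filterlim (\<lambda>N. n (m N)) at_top sequentially"
  proof (rule filterlim_at_top_mono[OF filterlim_ident])
    have "N \<le> n (m N)" for N
      using n[of "m N"] seq_suble[OF k, of "l N"] seq_suble[OF l, of N] by (simp add: m_def)
    then show "\<forall>\<^sub>F N in sequentially. N \<le> n (m N)" by simp
  qed
  from filterlim_compose[OF lim[OF \<tau>'0 \<psi>'_lip] this]
  have "(\<lambda>N. integral\<^sup>L (g (r (n (m N))) \<tau>') \<psi>') \<longlonglongrightarrow> integral\<^sup>L (\<nu> \<tau>') \<psi>'" .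
  then have ev1: "\<forall>\<^sub>F N in sequentially. dist (integral\<^sup>L (g (r (n (m N))) \<tau>') \<psi>') (integral\<^sup>L (\<nu> \<tau>') \<psi>') < e / 8"
    using e by (intro tendstoD) auto
  have "(\<lambda>N. C * \<bar>\<tau> (m N) - \<tau>'\<bar>) \<longlonglongrightarrow> C * \<bar>\<tau>' - \<tau>'\<bar>"
    unfolding m_def by (intro tendsto_intros \<tau>_lim)
  then have ev2: "\<forall>\<^sub>F N in sequentially. C * \<bar>\<tau> (m N) - \<tau>'\<bar> < e / 8"
    using e by (intro order_tendstoD(2)) auto
  obtain N0 where N0: "\<And>N z. N \<ge> N0 \<Longrightarrow> z \<in> KK \<Longrightarrow> \<bar>\<psi> (k N) z - \<psi>' z\<bar> < e / 8"
    using unif[of "e / 8"] e by auto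
  have "\<forall>\<^sub>F N in sequentially. False"
    using ev1 ev2 eventually_ge_at_top[of N0]
  proof eventually_elim
    case (elim N)
    have "l N \<ge> N0" using elim(3) seq_suble[OF l, of N] by linarith
    then have close: "\<bar>integral\<^sup>L M (\<psi> (m N)) - integral\<^sup>L M \<psi>'\<bar> \<le> e / 8" if "M \<in> PK" for M
      using e N0 unfolding m_def
      by (intro PK_integral_close that lipschitz_on_continuous_on[OF \<psi>_lip]
          lipschitz_on_continuous_on[OF \<psi>'_lip]) (auto intro: less_imp_le)
    have "\<bar>integral\<^sup>L (g (r (n (m N))) (\<tau> (m N))) \<psi>' - integral\<^sup>L (g (r (n (m N))) \<tau>') \<psi>'\<bar> < e / 8"
      using time_lipschitz[OF \<psi>'_lip \<tau>'0 \<tau>0[of "m N"], of "r (n (m N))"] elim(2) by simp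
    moreover have "\<bar>integral\<^sup>L (\<nu> (\<tau> (m N))) \<psi>' - integral\<^sup>L (\<nu> \<tau>') \<psi>'\<bar> < e / 8"
      using lip[OF \<psi>'_lip \<tau>'0 \<tau>0[of "m N"]] elim(2) by simp
    moreover note close[OF in_PK[OF \<tau>0[of "m N"], of "r (n (m N))"]]
      close[OF \<nu>[OF \<tau>0[of "m N"]]] gap'[of "m N"] elim(1)
    ultimately show False
      using e unfolding dist_real_def abs_less_iff abs_le_iff by linarith
  qed
  then show False by simp
qed

theorem converges_uniformly_in_W1:
  obtains r :: "nat \<Rightarrow> nat" and \<nu> where "strict_mono r" "\<And>\<tau>. 0 \<le> \<tau> \<Longrightarrow> \<nu> \<tau> \<in> PK"
    "weak_continuous_from_0 \<nu>"
    "\<And>T. 0 < T \<Longrightarrow> (\<lambda>k. SUP \<tau>\<in>{0..T}. W1 (g (r k) \<tau>) (\<nu> \<tau>)) \<longlonglongrightarrow> 0"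
proof -
  obtain r \<nu> where r: "strict_mono (r :: nat \<Rightarrow> nat)" and \<nu>: "\<And>\<tau>. 0 \<le> \<tau> \<Longrightarrow> \<nu> \<tau> \<in> PK"
    and lim: "\<And>\<tau> L (\<phi> :: real \<times> real \<Rightarrow> real). 0 \<le> \<tau> \<Longrightarrow> L-lipschitz_on KK \<phi> \<Longrightarrow>
      (\<lambda>n. integral\<^sup>L (g (r n) \<tau>) \<phi>) \<longlonglongrightarrow> integral\<^sup>L (\<nu> \<tau>) \<phi>"
    using subsequence_at_all_times by blast
  have lip: "\<bar>integral\<^sup>L (\<nu> \<tau>) \<phi> - integral\<^sup>L (\<nu> \<sigma>) \<phi>\<bar> \<le> C * L * \<bar>\<tau> - \<sigma>\<bar>"
    if \<phi>: "L-lipschitz_on KK \<phi>" and "0 \<le> \<sigma>" "0 \<le> \<tau>" for L \<phi> \<sigma> \<tau>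
  proof (rule LIMSEQ_le_const2)
    show "(\<lambda>n. \<bar>integral\<^sup>L (g (r n) \<tau>) \<phi> - integral\<^sup>L (g (r n) \<sigma>) \<phi>\<bar>)
        \<longlonglongrightarrow> \<bar>integral\<^sup>L (\<nu> \<tau>) \<phi> - integral\<^sup>L (\<nu> \<sigma>) \<phi>\<bar>"
      using that by (intro tendsto_intros lim)
  qed (use time_lipschitz[OF that] in blast)
  have "(\<lambda>k. SUP \<tau>\<in>{0..T}. W1 (g (r k) \<tau>) (\<nu> \<tau>)) \<longlonglongrightarrow> 0" if T: "0 < T" for T
  proof (rule LIMSEQ_I)
    fix e :: real assume e: "0 < e"
    have "\<exists>N. \<forall>n\<ge>N. \<forall>\<tau>\<in>{0..T}. \<forall>\<phi>. 1-lipschitz_on KK \<phi> \<longrightarrow>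
        integral\<^sup>L (g (r n) \<tau>) \<phi> - integral\<^sup>L (\<nu> \<tau>) \<phi> \<le> e / 2"
      by (rule uniform_over_lipschitz_and_time)
         (use \<nu> lim lip[where L = 1] half_gt_zero[OF e] in auto)
    then obtain N where N: "\<And>n \<tau> \<phi>. n \<ge> N \<Longrightarrow> \<tau> \<in> {0..T} \<Longrightarrow> 1-lipschitz_on KK \<phi> \<Longrightarrow>
        integral\<^sup>L (g (r n) \<tau>) \<phi> - integral\<^sup>L (\<nu> \<tau>) \<phi> \<le> e / 2"
      by blast
    have "norm ((SUP \<tau>\<in>{0..T}. W1 (g (r n) \<tau>) (\<nu> \<tau>)) - 0) < e" if n: "n \<ge> N" for n
    proof -
      have W: "0 \<le> W1 (g (r n) \<tau>) (\<nu> \<tau>)" "W1 (g (r n) \<tau>) (\<nu> \<tau>) \<le> e / 2" if \<tau>: "\<tau> \<in> {0..T}" for \<tau>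
        using W1_bounds[OF N[OF n \<tau>]] by auto
      have "(SUP \<tau>\<in>{0..T}. W1 (g (r n) \<tau>) (\<nu> \<tau>)) \<le> e / 2"
        by (rule cSUP_least) (use T W in auto)
      moreover have "0 \<le> (SUP \<tau>\<in>{0..T}. W1 (g (r n) \<tau>) (\<nu> \<tau>))"
        by (rule cSUP_upper2[where x = 0]) (use T W in \<open>auto intro!: bdd_aboveI2[of _ _ "e / 2"]\<close>)
      ultimately show ?thesis using e by simp
    qed
    then show "\<exists>N. \<forall>n\<ge>N. norm ((SUP \<tau>\<in>{0..T}. W1 (g (r n) \<tau>) (\<nu> \<tau>)) - 0) < e" by blast
  qed
  with that[OF r \<nu> weak_continuous_if_time_lipschitz[OF \<nu> lip]] show thesis by blast
qed

end

theorem theorem3p2: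
  fixes p \<alpha> :: real
    and f0S f0NS :: "(real \<times> real) measure"
    and f :: "real \<Rightarrow> real \<Rightarrow> (real \<times> real) measure"
  assumes p: "p \<in> {0..1}" and alpha: "\<alpha> \<in> {0..1}"
    and f0S: "f0S \<in> PK" and f0NS: "f0NS \<in> PK"
    and inPK: "\<And>\<gamma> t. \<gamma> \<in> {0<..<1} \<Longrightarrow> t \<ge> 0 \<Longrightarrow> f \<gamma> t \<in> PK"
    and init: "\<And>\<gamma>. \<gamma> \<in> {0<..<1} \<Longrightarrow> f \<gamma> 0 = f0NS"
    and cont: "\<And>\<gamma>. \<gamma> \<in> {0<..<1} \<Longrightarrow> tv_continuous_from_0 (f \<gamma>)"
    and C1: "\<And>\<gamma>. \<gamma> \<in> {0<..<1} \<Longrightarrow> tv_C1_pos (f \<gamma>)"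
    and eqn: "\<And>\<gamma> \<phi> t. \<gamma> \<in> {0<..<1} \<Longrightarrow> continuous_on KK \<phi> \<Longrightarrow> t > 0 \<Longrightarrow>
               ((\<lambda>s. integral\<^sup>L (f \<gamma> s) \<phi>) has_real_derivative
                  rhs p \<alpha> \<gamma> f0S (f \<gamma> t) \<phi>) (at t)"
  shows "\<exists>\<gamma>k :: nat \<Rightarrow> real. (\<forall>k. \<gamma>k k \<in> {0<..<1}) \<and> \<gamma>k \<longlonglongrightarrow> 0 \<and>
           (\<exists>fNS :: real \<Rightarrow> (real \<times> real) measure.
              (\<forall>\<tau>\<ge>0. fNS \<tau> \<in> PK) \<and> weak_continuous_from_0 fNS \<and>
              (\<forall>T>0. (\<lambda>k. SUP \<tau>\<in>{0..T}. W1 (f (\<gamma>k k) (\<tau> / \<gamma>k k)) (fNS \<tau>)) \<longlonglongrightarrow> 0))"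
proof -
  define \<gamma> where "\<gamma> n = inverse (real (Suc (Suc n)))" for n
  have \<gamma>: "\<gamma> n \<in> {0<..<1}" for n by (simp add: \<gamma>_def field_simps)
  have \<gamma>_lim: "\<gamma> \<longlonglongrightarrow> 0"
    unfolding \<gamma>_def by (rule LIMSEQ_Suc[OF LIMSEQ_inverse_real_of_nat])
  interpret equilipschitz_curves "\<lambda>n \<tau>. f (\<gamma> n) (\<tau> / \<gamma> n)" 2
  proof
    show "f (\<gamma> n) (\<tau> / \<gamma> n) \<in> PK" if "\<tau> \<ge> 0" for n \<tau>
      using inPK[OF \<gamma>] \<gamma>[of n] that by simp
    fix L and \<phi> :: "real \<times> real \<Rightarrow> real" and \<sigma> \<tau> :: real and n
    assume \<phi>: "L-lipschitz_on KK \<phi>" and t: "0 \<le> \<sigma>" "0 \<le> \<tau>"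
    have le: "\<bar>integral\<^sup>L (f (\<gamma> n) (b / \<gamma> n)) \<phi> - integral\<^sup>L (f (\<gamma> n) (a / \<gamma> n)) \<phi>\<bar> \<le> 2 * L * (b - a)"
      if ab: "0 \<le> a" "a \<le> b" for a b
    proof -
      have "\<bar>integral\<^sup>L (f (\<gamma> n) (b / \<gamma> n)) \<phi> - integral\<^sup>L (f (\<gamma> n) (a / \<gamma> n)) \<phi>\<bar>
          \<le> 2 * \<gamma> n * L * (b / \<gamma> n - a / \<gamma> n)"
        by (rule solution_lipschitz_in_time[where g = "f (\<gamma> n)", OF p alpha \<gamma> f0S inPK[OF \<gamma>] cont[OF \<gamma>] eqn[OF \<gamma>] \<phi>])
           (use ab \<gamma>[of n] in \<open>auto simp: divide_right_mono\<close>)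
      also have "\<dots> = 2 * L * (b - a)" using \<gamma>[of n] by (simp add: field_simps)
      finally show ?thesis .
    qed
    show "\<bar>integral\<^sup>L (f (\<gamma> n) (\<tau> / \<gamma> n)) \<phi> - integral\<^sup>L (f (\<gamma> n) (\<sigma> / \<gamma> n)) \<phi>\<bar> \<le> 2 * L * \<bar>\<tau> - \<sigma>\<bar>"
      using le[of \<sigma> \<tau>] le[of \<tau> \<sigma>] t by (cases "\<sigma> \<le> \<tau>") (auto simp: abs_minus_commute)
  qed
  obtain r \<nu> where "strict_mono r" "\<And>\<tau>. 0 \<le> \<tau> \<Longrightarrow> \<nu> \<tau> \<in> PK" "weak_continuous_from_0 \<nu>"
    "\<And>T. 0 < T \<Longrightarrow> (\<lambda>k. SUP \<tau>\<in>{0..T}. W1 (f (\<gamma> (r k)) (\<tau> / \<gamma> (r k))) (\<nu> \<tau>)) \<longlonglongrightarrow> 0"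
    using converges_uniformly_in_W1 by blast
  with \<gamma> LIMSEQ_subseq_LIMSEQ[OF \<gamma>_lim] show ?thesis
    by (intro exI[of _ "\<lambda>k. \<gamma> (r k)"]) (auto simp: o_def)
qed

end
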